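(* Let $f: \mathbb{N} \to \mathbb{R}$ be any non-decreasing function. There is a sequence $(a_n)_{n \geq 1}$ of (non-negative) integers such that $a_n \geq f(n)$ for all $n\ge 1$ and the Rademacher random walk associated with $(a_n)_{n\ge1}$ is recurrent.
   Context: Let $\epsilon_1, \epsilon_2, \dots$ be independent Rademacher random variables, taking values $\pm 1$ each with probability $1/2$. The Rademacher random walk associated with a deterministic sequence $(a_n)_{n\ge1}$ of non-negative reals is $(X_n)_{n\ge 0}$, $X_n = \sum_{k=1}^n \epsilon_k a_k$. The walk is recurrent if almost surely $X_n = 0$ for infinitely many $n$. *)

theory Defs
  imports "HOL-Probability.Probability"
begin

text \<open>Sequences are indexed from 1; the values of \<open>\<epsilon>\<close> and \<open>a\<close> at 0 are irrelevant.\<close>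

locale rademacher_sequence = prob_space M for M :: "'w measure" +
  fixes \<epsilon> :: "nat \<Rightarrow> 'w \<Rightarrow> real"
  assumes indep: "indep_vars (\<lambda>_. borel) \<epsilon> {1..}"
    and prob_plus: "n \<ge> 1 \<Longrightarrow> prob {\<omega> \<in> space M. \<epsilon> n \<omega> = 1} = 1 / 2"
    and prob_minus: "n \<ge> 1 \<Longrightarrow> prob {\<omega> \<in> space M. \<epsilon> n \<omega> = - 1} = 1 / 2"

definition rademacher_walk ::
    "(nat \<Rightarrow> 'w \<Rightarrow> real) \<Rightarrow> (nat \<Rightarrow> real) \<Rightarrow> nat \<Rightarrow> 'w \<Rightarrow> real" where
  "rademacher_walk \<epsilon> a n \<omega> = (\<Sum>k = 1..n. \<epsilon> k \<omega> * a k)"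

definition recurrent_walk :: "'w measure \<Rightarrow> (nat \<Rightarrow> 'w \<Rightarrow> real) \<Rightarrow> bool" where
  "recurrent_walk M X \<longleftrightarrow> (AE \<omega> in M. infinite {n. X n \<omega> = 0})"

end

theory Submission
  imports Defs
begin

text \<open>
  The steps are chosen in finite blocks. Block \<open>k\<close> is arranged so that the walk avoids \<open>0\<close>
  throughout it with probability at most \<open>2\<^sup>-\<^sup>k\<close>, whatever happened before; by the first
  Borel--Cantelli lemma, almost surely all but finitely many blocks then contain a zero.
  The obstacle is that the steps have to exceed \<open>f\<close>, so the \<^emph>\<open>length\<close> of a block may depend
  on the past (which bounds the position at its start by some \<open>S\<close>) but not on the size of its
  steps. Once the length is known, the steps can be taken as large as the value of \<open>f\<close>
  at the end of the block demands, since \<open>f\<close> is monotone.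

  Only steps \<open>A\<close> and \<open>A + 1\<close> occur in a block. Writing the position as \<open>u * A + v\<close>, a step \<open>A\<close>
  moves \<open>u\<close> by \<open>\<plusminus>1\<close>, a step \<open>A + 1\<close> moves \<open>u\<close> and \<open>v\<close> together by \<open>\<plusminus>1\<close>, and the walk is
  at \<open>0\<close> as soon as \<open>u = v = 0\<close>. The block consists of windows: a long run of steps \<open>A\<close>,
  then a single step \<open>A + 1\<close>. From one window to the next, \<open>v\<close> performs a simple
  random walk on the integers, so with high probability it is \<open>0\<close> in one of the first \<open>R + 1\<close>
  windows, if \<open>R\<close> is large in terms of \<open>S\<close>. During that window \<open>v\<close> stays \<open>0\<close> while \<open>u\<close>
  performs a simple random walk, which starts within a bound known in advance;
  if the window is long enough, \<open>u\<close> visits \<open>0\<close> with high probability.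
  Neither \<open>R\<close> nor the lengths of the windows depend on \<open>A\<close>. The only
  input is that the simple random walk on the integers visits \<open>0\<close> almost surely
  (\<open>avoidance_simple_walk_tendsto_0\<close>); it is used for \<open>u\<close> once per window (\<open>windows\<close>)
  and then once for \<open>v\<close> (\<open>block_exists\<close>).

  Avoidance probabilities are computed by a recursion over the list of steps
  (\<open>avoidance\<close>). Its connection with the given random variables is made by conditioning on
  the first signs (\<open>prob_avoid_le\<close>).
\<close>

section \<open>Avoidance probabilities of finite walks\<close>

text \<open>
  The probability that the walk with the given steps and independent uniform signs, started
  at \<open>x\<close>, is never at \<open>0\<close>, the starting time included.
\<close>

fun avoidance :: "'a::ab_group_add list \<Rightarrow> 'a \<Rightarrow> real" where
  "avoidance [] x = (if x = 0 then 0 else 1)"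
| "avoidance (a # as) x =
     (if x = 0 then 0 else (avoidance as (x + a) + avoidance as (x - a)) / 2)"

lemma avoidance_nonneg: "0 \<le> avoidance as x"
  by (induction as arbitrary: x) (auto intro!: add_nonneg_nonneg)

lemma avoidance_le_1: "avoidance as x \<le> 1"
  by (induction as x rule: avoidance.induct) auto

lemma avoidance_0 [simp]: "avoidance as 0 = 0"
  by (cases as) auto

lemma avoidance_append_le: "avoidance (as @ bs) x \<le> avoidance as x"
proof (induction as arbitrary: x)
  case Nil
  then show ?case by (simp add: avoidance_le_1)
next
  case (Cons a as)
  show ?case
    using add_mono[OF Cons[of "x + a"] Cons[of "x - a"]] by simp
qed

text \<open>
  A homomorphism maps zeros of a path to zeros of the image path. It may create further zeros,
  hence only an inequality.
\<close>

lemma avoidance_map_le: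
  assumes "Modules.additive \<phi>"
  shows "avoidance (map \<phi> as) (\<phi> x) \<le> avoidance as x"
proof (induction as arbitrary: x)
  case Nil
  then show ?case by (simp add: Modules.additive.zero[OF assms])
next
  case (Cons a as)
  show ?case
    using add_mono[OF Cons[of "x + a"] Cons[of "x - a"]]
    by (simp add: Modules.additive.zero[OF assms] Modules.additive.add[OF assms]
        Modules.additive.diff[OF assms] add_nonneg_nonneg avoidance_nonneg)
qed

lemma avoidance_replicate_append_le:
  fixes a x :: "'a::ring_1"
  assumes "0 \<le> c"
    and "\<And>j. \<bar>j\<bar> \<le> int N \<Longrightarrow> avoidance bs (x + of_int j * a) \<le> c"
  shows "avoidance (replicate N a @ bs) x \<le> c"
  using assms(2)
proof (induction N arbitrary: x)
  case 0
  from 0[of 0] show ?case by simp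
next
  case (Suc N)
  have "avoidance (replicate N a @ bs) (x + a) \<le> c"
  proof (rule Suc.IH)
    fix j assume "\<bar>j\<bar> \<le> int N"
    then show "avoidance bs (x + a + of_int j * a) \<le> c"
      using Suc.prems[of "j + 1"] by (simp add: algebra_simps)
  qed
  moreover have "avoidance (replicate N a @ bs) (x - a) \<le> c"
  proof (rule Suc.IH)
    fix j assume "\<bar>j\<bar> \<le> int N"
    then show "avoidance bs (x - a + of_int j * a) \<le> c"
      using Suc.prems[of "j - 1"] by (simp add: algebra_simps)
  qed
  ultimately show ?case
    using \<open>0 \<le> c\<close> by simp
qed

section \<open>Recurrence of the simple random walk on the integers\<close>

text \<open>
  A discrete harmonic function on the half-line with boundary value \<open>0\<close> is linear, so if it is
  bounded it vanishes.
\<close>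

lemma bounded_harmonic_half_line:
  fixes g :: "nat \<Rightarrow> real"
  assumes g0: "g 0 = 0"
    and harmonic: "\<And>n. g (Suc n) = (g (Suc (Suc n)) + g n) / 2"
    and bounds: "\<And>n. 0 \<le> g n" "\<And>n. g n \<le> 1"
  shows "g n = 0"
proof -
  have linear: "g n = real n * g 1 \<and> g (Suc n) = real (Suc n) * g 1" for n
  proof (induction n)
    case (Suc n)
    then show ?case
      using harmonic[of n] by (simp add: algebra_simps)
  qed (simp add: g0)
  have "g 1 \<le> 0"
  proof (rule ccontr)
    assume "\<not> g 1 \<le> 0"
    then obtain n :: nat where "1 < real n * g 1"
      using reals_Archimedean3[of "g 1"] by auto
    then show False
      using linear[of n] bounds(2)[of n] by simp
  qed
  then have "g 1 = 0"
    using bounds(1)[of 1] by simp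
  then show ?thesis
    using linear[of n] by simp
qed

text \<open>
  The avoidance probability decreases with the number of steps, and its limit is harmonic
  away from \<open>0\<close>; the two half-lines are treated separately.
\<close>

lemma avoidance_simple_walk_tendsto_0:
  "(\<lambda>N. avoidance (replicate N 1) (x::int)) \<longlonglongrightarrow> 0"
proof -
  let ?q = "\<lambda>N x. avoidance (replicate N (1::int)) x"
  have dec: "decseq (\<lambda>N. ?q N x)" for x
  proof (rule decseq_SucI)
    fix N
    show "?q (Suc N) x \<le> ?q N x"
      using avoidance_append_le[of "replicate N 1" "[1]" x]
      by (simp add: replicate_append_same flip: replicate_Suc)
  qed
  have "\<exists>L. (\<lambda>N. ?q N x) \<longlonglongrightarrow> L" for x
    using decseq_convergent[OF dec, where B = 0] avoidance_nonneg by metis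
  then obtain h where h: "\<And>x. (\<lambda>N. ?q N x) \<longlonglongrightarrow> h x"
    by metis
  have h0: "h 0 = 0"
    using LIMSEQ_unique[OF h[of 0]] by simp
  have nonneg: "0 \<le> h x" for x
    using LIMSEQ_le_const[OF h] avoidance_nonneg by blast
  have le_1: "h x \<le> 1" for x
    using LIMSEQ_le_const2[OF h] avoidance_le_1 by blast
  have harmonic: "h x = (h (x + 1) + h (x - 1)) / 2" if "x \<noteq> 0" for x
  proof -
    have "(\<lambda>N. ?q (Suc N) x) \<longlonglongrightarrow> h x"
      using LIMSEQ_Suc[OF h] .
    moreover have "(\<lambda>N. ?q (Suc N) x) \<longlonglongrightarrow> (h (x + 1) + h (x - 1)) / 2"
      using that by (auto intro!: tendsto_intros h)
    ultimately show ?thesis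
      by (rule LIMSEQ_unique)
  qed
  have "h (int n) = 0" for n
  proof (rule bounded_harmonic_half_line[where g = "\<lambda>n. h (int n)"])
    fix n show "h (int (Suc n)) = (h (int (Suc (Suc n))) + h (int n)) / 2"
      using harmonic[of "int (Suc n)"] by (simp add: add_ac)
  qed (simp_all add: h0 nonneg le_1)
  moreover have "h (- int n) = 0" for n
  proof (rule bounded_harmonic_half_line[where g = "\<lambda>n. h (- int n)"])
    fix n
    have "- int (Suc n) + 1 = - int n" "- int (Suc n) - 1 = - int (Suc (Suc n))"
      by simp_all
    then show "h (- int (Suc n)) = (h (- int (Suc (Suc n))) + h (- int n)) / 2"
      using harmonic[of "- int (Suc n)"] by simp
  qed (simp_all add: h0 nonneg le_1)
  ultimately have "h x = 0"
    by (cases x rule: int_cases2) auto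
  then show ?thesis
    using h[of x] by simp
qed

lemma avoidance_simple_walk_uniform:
  fixes U :: int
  assumes "0 < \<delta>"
  shows "\<exists>N. \<forall>u. \<bar>u\<bar> \<le> U \<longrightarrow> avoidance (replicate N 1) u \<le> \<delta>"
proof -
  have "eventually (\<lambda>N. avoidance (replicate N 1) u < \<delta>) sequentially" for u :: int
    using order_tendstoD(2)[OF avoidance_simple_walk_tendsto_0 assms] .
  then have "eventually (\<lambda>N. \<forall>u\<in>{-U..U}. avoidance (replicate N 1) u < \<delta>) sequentially"
    by (intro eventually_ball_finite) auto
  then obtain N where "\<forall>u\<in>{-U..U}. avoidance (replicate N 1) u < \<delta>"
    by (auto simp: eventually_sequentially)
  then show ?thesis
    by (intro exI[of _ N]) (auto simp: abs_le_iff intro!: less_imp_le)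
qed

section \<open>Blocks of bounded length with arbitrarily large steps\<close>

text \<open>
  The list \<open>bs\<close> prescribes \<open>R + 1\<close> windows; an entry \<open>b\<close> stands for a step \<open>A + b\<close>. The first
  summand of the bound is the probability that \<open>v\<close>, viewed from window to window, avoids \<open>0\<close>.
  The second one bounds the probability that \<open>u\<close> avoids \<open>0\<close> during the first window with
  \<open>v = 0\<close>: the induction stops at that window, so the errors of the
  windows do not add up.
\<close>

lemma windows:
  fixes U :: int
  assumes "0 < \<delta>"
  shows "\<exists>bs :: nat list. \<forall>A u v. \<bar>u\<bar> \<le> U \<longrightarrow>
    avoidance (map (\<lambda>b. A + int b) bs) (u * A + v) \<le> avoidance (replicate R 1) v + \<delta>"
proof (induction R arbitrary: U)
  case 0
  obtain N where N: "\<And>u. \<bar>u\<bar> \<le> U \<Longrightarrow> avoidance (replicate N 1) u \<le> \<delta>"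
    using avoidance_simple_walk_uniform[OF assms] by metis
  show ?case
  proof (intro exI[of _ "replicate N 0"] allI impI)
    fix A u v :: int
    assume u: "\<bar>u\<bar> \<le> U"
    show "avoidance (map (\<lambda>b. A + int b) (replicate N 0)) (u * A + v)
        \<le> avoidance (replicate 0 1) v + \<delta>"
    proof (cases "v = 0")
      case True
      have "avoidance (map (\<lambda>u. u * A) (replicate N 1)) (u * A) \<le> avoidance (replicate N 1) u"
        by (intro avoidance_map_le Modules.additive.intro) (simp add: distrib_right)
      then show ?thesis
        using N[OF u] True by simp
    next
      case False
      then show ?thesis
        using avoidance_le_1[of "replicate N A" "u * A + v"] assms by simp
    qed
  qed
next
  case (Suc R)
  obtain N where N: "\<And>u. \<bar>u\<bar> \<le> U \<Longrightarrow> avoidance (replicate N 1) u \<le> \<delta>"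
    using avoidance_simple_walk_uniform[OF assms] by metis
  \<comment> \<open>a window of length \<open>N + 1\<close> can move \<open>u\<close> by at most \<open>N + 1\<close>\<close>
  obtain bs :: "nat list" where bs: "\<And>A u v. \<bar>u\<bar> \<le> U + int N + 1 \<Longrightarrow>
      avoidance (map (\<lambda>b. A + int b) bs) (u * A + v) \<le> avoidance (replicate R 1) v + \<delta>"
    using Suc.IH[of "U + int N + 1"] by metis
  show ?case
  proof (intro exI[of _ "replicate N 0 @ 1 # bs"] allI impI)
    fix A u v :: int
    assume u: "\<bar>u\<bar> \<le> U"
    let ?rest = "(A + 1) # map (\<lambda>b. A + int b) bs"
    have "avoidance (replicate N A @ ?rest) (u * A + v) \<le> avoidance (replicate (Suc R) 1) v + \<delta>"
    proof (cases "v = 0")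
      case True
      have "avoidance (replicate N A @ ?rest) (u * A) \<le> avoidance (replicate N A) (u * A)"
        by (rule avoidance_append_le)
      also have "\<dots> = avoidance (map (\<lambda>u. u * A) (replicate N 1)) (u * A)"
        by simp
      also have "\<dots> \<le> avoidance (replicate N 1) u"
        by (intro avoidance_map_le Modules.additive.intro) (simp add: distrib_right)
      finally show ?thesis
        using N[OF u] True by simp
    next
      case False
      let ?c = "avoidance (replicate (Suc R) 1) v + \<delta>"
      have c: "0 \<le> ?c"
        using assms avoidance_nonneg[of "replicate (Suc R) 1" v] by linarith
      show ?thesis
      proof (rule avoidance_replicate_append_le[OF c])
        fix j assume j: "\<bar>j\<bar> \<le> int N"
        have "avoidance (map (\<lambda>b. A + int b) bs) ((u + j + 1) * A + (v + 1))
            \<le> avoidance (replicate R 1) (v + 1) + \<delta>"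
          using u j by (intro bs) linarith
        moreover have "avoidance (map (\<lambda>b. A + int b) bs) ((u + j - 1) * A + (v - 1))
            \<le> avoidance (replicate R 1) (v - 1) + \<delta>"
          using u j by (intro bs) linarith
        moreover have "(u + j + 1) * A + (v + 1) = u * A + v + j * A + (A + 1)"
          "(u + j - 1) * A + (v - 1) = u * A + v + j * A - (A + 1)"
          by (simp_all add: algebra_simps)
        ultimately have
          "(avoidance (map (\<lambda>b. A + int b) bs) (u * A + v + j * A + (A + 1))
            + avoidance (map (\<lambda>b. A + int b) bs) (u * A + v + j * A - (A + 1))) / 2 \<le> ?c"
          using False by (simp add: field_simps)
        then show "avoidance ?rest (u * A + v + of_int j * A) \<le> ?c"
          using c by simp
      qed
    qed
    then show "avoidance (map (\<lambda>b. A + int b) (replicate N 0 @ 1 # bs)) (u * A + v)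
        \<le> avoidance (replicate (Suc R) 1) v + \<delta>"
      by simp
  qed
qed

text \<open>
  The same list \<open>bs\<close> serves all \<open>A\<close>, so that \<open>A\<close> can be chosen when the length of the
  block is already known.
\<close>

lemma block_exists:
  fixes S :: nat
  assumes "0 < \<delta>"
  shows "\<exists>bs :: nat list. bs \<noteq> [] \<and> (\<forall>A x. \<bar>x\<bar> \<le> int S \<longrightarrow>
    avoidance (map (\<lambda>b. real (A + b)) bs) (of_int x) \<le> \<delta>)"
proof -
  have half: "0 < \<delta> / 2"
    using assms by simp
  obtain R where R: "\<And>v. \<bar>v\<bar> \<le> int S \<Longrightarrow> avoidance (replicate R 1) v \<le> \<delta> / 2"
    using avoidance_simple_walk_uniform[OF half] by metis
  obtain bs :: "nat list" where bs: "\<And>A u v. \<bar>u\<bar> \<le> 0 \<Longrightarrow>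
      avoidance (map (\<lambda>b. A + int b) bs) (u * A + v) \<le> avoidance (replicate R 1) v + \<delta> / 2"
    using windows[OF half] by metis
  have "avoidance (map (\<lambda>b. real (A + b)) (bs @ [0])) (of_int x) \<le> \<delta>"
    if x: "\<bar>x\<bar> \<le> int S" for A x
  proof -
    have "avoidance (map (\<lambda>b. real (A + b)) (bs @ [0])) (of_int x)
        \<le> avoidance (map (\<lambda>b. real (A + b)) bs) (of_int x)"
      unfolding map_append by (rule avoidance_append_le)
    also have "map (\<lambda>b. real (A + b)) bs = map of_int (map (\<lambda>b. int A + int b) bs)"
      by simp
    also have "avoidance \<dots> (of_int x) \<le> avoidance (map (\<lambda>b. int A + int b) bs) x"
      by (intro avoidance_map_le Modules.additive.intro) simp
    also have "\<dots> \<le> avoidance (replicate R 1) x + \<delta> / 2"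
      using bs[of 0 "int A" x] by simp
    also have "\<dots> \<le> \<delta>"
      using R[OF x] by simp
    finally show ?thesis .
  qed
  then show ?thesis
    by (intro exI[of _ "bs @ [0]"]) simp
qed

section \<open>Avoidance of zero by the Rademacher walk\<close>

definition sign_sequence :: "(nat \<Rightarrow> real) \<Rightarrow> bool" where
  "sign_sequence s \<longleftrightarrow> (\<forall>k. s k = 1 \<or> s k = - 1)"

lemma sign_sequence_update:
  "sign_sequence s \<Longrightarrow> sign_sequence (s(n := 1))"
  "sign_sequence s \<Longrightarrow> sign_sequence (s(n := - 1))"
  by (auto simp: sign_sequence_def)

context rademacher_sequence
begin

definition cylinder :: "nat \<Rightarrow> (nat \<Rightarrow> real) \<Rightarrow> 'w set" where
  "cylinder n s = {\<omega> \<in> space M. \<forall>k\<in>{1..n}. \<epsilon> k \<omega> = s k}"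

definition avoid :: "(nat \<Rightarrow> real) \<Rightarrow> nat \<Rightarrow> nat \<Rightarrow> 'w set" where
  "avoid a m n = {\<omega> \<in> space M. \<forall>j\<in>{m..n}. rademacher_walk \<epsilon> a j \<omega> \<noteq> 0}"

lemma measurable_sign: "1 \<le> k \<Longrightarrow> \<epsilon> k \<in> borel_measurable M"
  using indep by (auto simp: indep_vars_def)

lemma measurable_walk: "rademacher_walk \<epsilon> a n \<in> borel_measurable M"
  unfolding rademacher_walk_def
  by (intro borel_measurable_sum borel_measurable_times measurable_sign) auto

lemma walk_on_cylinder:
  "\<omega> \<in> cylinder n s \<Longrightarrow> rademacher_walk \<epsilon> a n \<omega> = (\<Sum>k = 1..n. s k * a k)"
  unfolding rademacher_walk_def by (intro sum.cong) (auto simp: cylinder_def)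

lemma cylinder_events: "cylinder n s \<in> events"
proof -
  have "{\<omega> \<in> space M. \<epsilon> k \<omega> = s k} \<in> events" if "k \<in> {1..n}" for k
    using measurable_sign[of k] that by simp
  then show ?thesis
    unfolding cylinder_def by (intro sets.sets_Collect_finite_All) auto
qed

lemma avoid_events: "avoid a m n \<in> events"
proof -
  have "{\<omega> \<in> space M. rademacher_walk \<epsilon> a j \<omega> \<noteq> 0} \<in> events" for j
    using measurable_walk[of a j] by simp
  then show ?thesis
    unfolding avoid_def by (intro sets.sets_Collect_finite_All) auto
qed

lemma AE_sign:
  assumes "1 \<le> n"
  shows "AE \<omega> in M. \<epsilon> n \<omega> = 1 \<or> \<epsilon> n \<omega> = - 1"
proof -
  let ?P = "{\<omega> \<in> space M. \<epsilon> n \<omega> = 1}" and ?N = "{\<omega> \<in> space M. \<epsilon> n \<omega> = - 1}"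
  have "?P \<in> events" "?N \<in> events"
    using measurable_sign[OF assms] by simp_all
  moreover have "?P \<inter> ?N = {}"
    by auto
  ultimately have "prob (?P \<union> ?N) = 1"
    using prob_plus[OF assms] prob_minus[OF assms] by (simp add: finite_measure_Union)
  then have "AE \<omega> in M. \<omega> \<in> ?P \<union> ?N"
    by (rule prob_eq_1[THEN iffD1, rotated]) (use \<open>?P \<in> events\<close> \<open>?N \<in> events\<close> in auto)
  then show ?thesis
    by eventually_elim auto
qed

lemma prob_cylinder:
  assumes "sign_sequence s"
  shows "prob (cylinder n s) = (1 / 2) ^ n"
proof (cases "n = 0")
  case True
  then show ?thesis by (simp add: cylinder_def prob_space)
next
  case False
  have "cylinder n s = (\<Inter>k\<in>{1..n}. \<epsilon> k -` {s k} \<inter> space M)"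
    using False by (auto simp: cylinder_def)
  also have "prob \<dots> = (\<Prod>k\<in>{1..n}. prob (\<epsilon> k -` {s k} \<inter> space M))"
    using False by (intro indep_varsD[OF indep]) auto
  also have "\<dots> = (\<Prod>k\<in>{1..n}. 1 / 2)"
  proof (rule prod.cong)
    fix k assume k: "k \<in> {1..n}"
    have "\<epsilon> k -` {c} \<inter> space M = {\<omega> \<in> space M. \<epsilon> k \<omega> = c}" for c
      by auto
    then show "prob (\<epsilon> k -` {s k} \<inter> space M) = 1 / 2"
      using assms k prob_plus[of k] prob_minus[of k] unfolding sign_sequence_def
      by (metis atLeastAtMost_iff)
  qed simp
  finally show ?thesis by simp
qed

lemma prob_cylinder_split:
  assumes "D \<in> events"
  shows "prob (cylinder n s \<inter> D) \<le> prob (cylinder (Suc n) (s(Suc n := 1)) \<inter> D)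
    + prob (cylinder (Suc n) (s(Suc n := - 1)) \<inter> D)"
proof -
  let ?P = "cylinder (Suc n) (s(Suc n := 1)) \<inter> D"
  let ?N = "cylinder (Suc n) (s(Suc n := - 1)) \<inter> D"
  have events: "?P \<in> events" "?N \<in> events"
    using cylinder_events assms by auto
  have "1 \<le> Suc n"
    by simp
  from AE_sign[OF this] have "AE \<omega> in M. \<omega> \<in> cylinder n s \<inter> D \<longrightarrow> \<omega> \<in> ?P \<union> ?N"
    by eventually_elim (auto simp: cylinder_def le_Suc_eq)
  then have "prob (cylinder n s \<inter> D) \<le> prob (?P \<union> ?N)"
    using events by (intro finite_measure_mono_AE) auto
  also have "\<dots> \<le> prob ?P + prob ?N"
    using events by (rule measure_Un_le)
  finally show ?thesis .
qed

text \<open>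
  The recursion for \<open>avoidance\<close> is the conditioning on the next sign; the factor
  \<open>(1 / 2) ^ n\<close> is the probability of the cylinder conditioned on.
\<close>

lemma prob_cylinder_avoid_le:
  assumes "sign_sequence s"
  shows "prob (cylinder n s \<inter> avoid a n (n + m))
    \<le> (1 / 2) ^ n * avoidance (map a [Suc n..<Suc (n + m)]) (\<Sum>k = 1..n. s k * a k)"
  using assms
proof (induction m arbitrary: n s)
  case (0 n s)
  have "cylinder n s \<inter> avoid a n n = {}" if "(\<Sum>k = 1..n. s k * a k) = 0"
    using that walk_on_cylinder[of _ n s a] by (force simp: avoid_def)
  moreover have "prob (cylinder n s \<inter> avoid a n n) \<le> prob (cylinder n s)"
    by (intro finite_measure_mono cylinder_events) auto
  ultimately show ?case
    using prob_cylinder[OF 0] by auto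
next
  case (Suc m n s)
  let ?x = "\<Sum>k = 1..n. s k * a k"
  let ?D = "avoid a (Suc n) (Suc n + m)"
  let ?p = "s(Suc n := 1)" and ?m = "s(Suc n := - 1)"
  let ?as = "map a [Suc (Suc n)..<Suc (Suc n + m)]"
  show ?case
  proof (cases "?x = 0")
    case True
    then have "cylinder n s \<inter> avoid a n (n + Suc m) = {}"
      using walk_on_cylinder[of _ n s a] by (force simp: avoid_def)
    then show ?thesis
      by (simp add: avoidance_nonneg)
  next
    case False
    have position: "(\<Sum>k = 1..Suc n. (s(Suc n := c)) k * a k) = ?x + c * a (Suc n)" for c
    proof -
      have "(\<Sum>k = 1..n. (s(Suc n := c)) k * a k) = ?x"
        by (intro sum.cong) auto
      then show ?thesis by simp
    qed
    have plus: "prob (cylinder (Suc n) ?p \<inter> ?D) \<le> (1 / 2) ^ Suc n * avoidance ?as (?x + a (Suc n))"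
    proof -
      have "prob (cylinder (Suc n) ?p \<inter> ?D)
          \<le> (1 / 2) ^ Suc n * avoidance ?as (\<Sum>k = 1..Suc n. ?p k * a k)"
        by (intro Suc.IH sign_sequence_update Suc.prems)
      then show ?thesis
        unfolding position by (simp del: upt_Suc)
    qed
    have minus: "prob (cylinder (Suc n) ?m \<inter> ?D) \<le> (1 / 2) ^ Suc n * avoidance ?as (?x - a (Suc n))"
    proof -
      have "prob (cylinder (Suc n) ?m \<inter> ?D)
          \<le> (1 / 2) ^ Suc n * avoidance ?as (\<Sum>k = 1..Suc n. ?m k * a k)"
        by (intro Suc.IH sign_sequence_update Suc.prems)
      then show ?thesis
        unfolding position by (simp del: upt_Suc)
    qed
    have "prob (cylinder n s \<inter> avoid a n (n + Suc m)) \<le> prob (cylinder n s \<inter> ?D)"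
      by (intro finite_measure_mono sets.Int cylinder_events avoid_events) (auto simp: avoid_def)
    also have "\<dots> \<le> prob (cylinder (Suc n) ?p \<inter> ?D) + prob (cylinder (Suc n) ?m \<inter> ?D)"
      by (intro prob_cylinder_split avoid_events)
    also have "\<dots> \<le> (1 / 2) ^ Suc n * avoidance ?as (?x + a (Suc n))
        + (1 / 2) ^ Suc n * avoidance ?as (?x - a (Suc n))"
      using plus minus by (rule add_mono)
    also have "\<dots> = (1 / 2) ^ n * avoidance (a (Suc n) # ?as) ?x"
      using False by (simp add: field_simps)
    also have "a (Suc n) # ?as = map a [Suc n..<Suc (n + Suc m)]"
      by (simp add: upt_conv_Cons del: upt_Suc)
    finally show ?thesis .
  qed
qed

text \<open>
  The conditioning on the first \<open>n\<close> signs is removed one sign at a time, by downward induction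
  on the length of the cylinder.
\<close>

lemma prob_avoid_le:
  assumes "\<And>s. sign_sequence s \<Longrightarrow>
    avoidance (map a [Suc n..<Suc (n + m)]) (\<Sum>k = 1..n. s k * a k) \<le> \<delta>"
  shows "prob (avoid a n (n + m)) \<le> \<delta>"
proof -
  have *: "prob (cylinder i s \<inter> avoid a n (n + m)) \<le> (1 / 2) ^ i * \<delta>"
    if "i \<le> n" "sign_sequence s" for i s
    using that
  proof (induction i arbitrary: s rule: inc_induct)
    case base
    show ?case
      by (rule order_trans[OF prob_cylinder_avoid_le[OF base] mult_left_mono[OF assms[OF base]]]) simp
  next
    case (step i)
    have "prob (cylinder (Suc i) (s(Suc i := 1)) \<inter> avoid a n (n + m)) \<le> (1 / 2) ^ Suc i * \<delta>"
      by (intro step.IH sign_sequence_update step.prems)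
    moreover have
      "prob (cylinder (Suc i) (s(Suc i := - 1)) \<inter> avoid a n (n + m)) \<le> (1 / 2) ^ Suc i * \<delta>"
      by (intro step.IH sign_sequence_update step.prems)
    ultimately show ?case
      using prob_cylinder_split[OF avoid_events, of i s a n "n + m"] by simp
  qed
  have "cylinder 0 s \<inter> avoid a n (n + m) = avoid a n (n + m)" for s
    by (auto simp: cylinder_def avoid_def)
  then show ?thesis
    using *[of 0 "\<lambda>_. 1"] by (simp add: sign_sequence_def)
qed

text \<open>
  Consecutive time intervals share an endpoint, so a zero may be counted twice. This is
  harmless: there are zeros at or after every \<open>t k\<close>.
\<close>

lemma recurrent_if_summable_avoid:
  assumes "\<And>k. t k < t (Suc k)"
    and "summable (\<lambda>k. prob (avoid a (t k) (t (Suc k))))"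
  shows "recurrent_walk M (rademacher_walk \<epsilon> a)"
proof -
  have "strict_mono t"
    using assms(1) by (rule strict_monoI_Suc)
  have "AE \<omega> in M. eventually (\<lambda>k. \<omega> \<in> space M - avoid a (t k) (t (Suc k))) sequentially"
    using assms(2) by (intro borel_cantelli_AE1 avoid_events) (simp_all add: emeasure_eq_measure)
  then show ?thesis
    unfolding recurrent_walk_def
  proof eventually_elim
    case (elim \<omega>)
    then obtain K where K: "\<And>k. K \<le> k \<Longrightarrow> \<omega> \<in> space M - avoid a (t k) (t (Suc k))"
      by (auto simp: eventually_sequentially)
    show "infinite {n. rademacher_walk \<epsilon> a n \<omega> = 0}"
      unfolding infinite_nat_iff_unbounded_le
    proof
      fix m
      obtain j where "t (max K m) \<le> j" "rademacher_walk \<epsilon> a j \<omega> = 0"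
        using K[of "max K m"] by (auto simp: avoid_def)
      moreover have "m \<le> t (max K m)"
        using strict_mono_imp_increasing[OF \<open>strict_mono t\<close>, of "max K m"] by linarith
      ultimately show "\<exists>n\<ge>m. n \<in> {n. rademacher_walk \<epsilon> a n \<omega> = 0}"
        using order_trans by blast
    qed
  qed
qed

end

section \<open>Concatenation of the blocks\<close>

text \<open>
  The steps fixed before block \<open>k\<close> form the list \<open>P k\<close>, in which step \<open>n\<close> has index \<open>n - 1\<close>.
  The sum of \<open>P k\<close> bounds the position at the start of the block.
\<close>

lemma blocks_exist:
  fixes f :: "nat \<Rightarrow> real"
  assumes "mono_on {1..} f"
  shows "\<exists>P :: nat \<Rightarrow> nat list. \<forall>k. (\<forall>i < length (P k). f (Suc i) \<le> real (P k ! i)) \<and>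
    (\<exists>cs. cs \<noteq> [] \<and> P (Suc k) = P k @ cs \<and>
      (\<forall>x. \<bar>x\<bar> \<le> int (sum_list (P k)) \<longrightarrow> avoidance (map real cs) (of_int x) \<le> (1 / 2) ^ k))"
proof (rule dependent_nat_choice)
  show "\<exists>L :: nat list. \<forall>i < length L. f (Suc i) \<le> real (L ! i)"
    by (intro exI[of _ "[]"]) simp
next
  fix L :: "nat list" and k :: nat
  assume L: "\<forall>i < length L. f (Suc i) \<le> real (L ! i)"
  obtain bs :: "nat list" where "bs \<noteq> []" and bs: "\<And>A x. \<bar>x\<bar> \<le> int (sum_list L) \<Longrightarrow>
      avoidance (map (\<lambda>b. real (A + b)) bs) (of_int x) \<le> (1 / 2) ^ k"
    using block_exists[of "(1 / 2) ^ k" "sum_list L"] by auto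
  define A where "A = nat \<lceil>f (length L + length bs)\<rceil>"
  have A: "f (Suc i) \<le> real A" if "i < length L + length bs" for i
  proof -
    have "f (Suc i) \<le> f (length L + length bs)"
      using that by (intro mono_onD[OF assms]) auto
    also have "\<dots> \<le> real A"
      unfolding A_def by (rule real_nat_ceiling_ge)
    finally show ?thesis .
  qed
  define cs where "cs = map (\<lambda>b. A + b) bs"
  have "f (Suc i) \<le> real ((L @ cs) ! i)" if "i < length (L @ cs)" for i
  proof (cases "i < length L")
    case True
    then show ?thesis using L by (simp add: nth_append)
  next
    case False
    have "f (Suc i) \<le> real A"
      using that by (intro A) (simp add: cs_def)
    then show ?thesis
      using False that by (simp add: nth_append cs_def)
  qed
  moreover have "map real cs = map (\<lambda>b. real (A + b)) bs"
    by (simp add: cs_def)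
  ultimately show "\<exists>L' :: nat list. (\<forall>i < length L'. f (Suc i) \<le> real (L' ! i)) \<and>
    (\<exists>cs. cs \<noteq> [] \<and> L' = L @ cs \<and>
      (\<forall>x. \<bar>x\<bar> \<le> int (sum_list L) \<longrightarrow> avoidance (map real cs) (of_int x) \<le> (1 / 2) ^ k))"
    using \<open>bs \<noteq> []\<close> bs by (intro exI[where x = "L @ cs"]) (simp add: cs_def o_def)
qed

lemma nth_of_increasing_prefixes:
  fixes P :: "nat \<Rightarrow> 'a list"
  assumes ext: "\<And>k. \<exists>cs. cs \<noteq> [] \<and> P (Suc k) = P k @ cs"
    and "i < length (P k)"
  shows "P (Suc i) ! i = P k ! i"
proof -
  have increasing: "\<exists>cs. P l = P k @ cs" if "k \<le> l" for k l
    using that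
  proof (induction l rule: dec_induct)
    case (step l)
    then show ?case using ext[of l] by (metis append.assoc)
  qed simp
  have "strict_mono (\<lambda>k. length (P k))"
  proof (rule strict_monoI_Suc)
    fix k show "length (P k) < length (P (Suc k))"
      using ext[of k] by auto
  qed
  then have "Suc i \<le> length (P (Suc i))"
    by (rule strict_mono_imp_increasing)
  then show ?thesis
    using increasing[of k "Suc i"] increasing[of "Suc i" k] assms(2)
    by (cases "k \<le> Suc i") (auto simp: nth_append)
qed

theorem theorem3:
  fixes M :: "'w measure" and \<epsilon> :: "nat \<Rightarrow> 'w \<Rightarrow> real" and f :: "nat \<Rightarrow> real"
  assumes "rademacher_sequence M \<epsilon>"
    and "mono_on {1..} f"
  shows "\<exists>a :: nat \<Rightarrow> nat. (\<forall>n\<ge>1. real (a n) \<ge> f n) \<and>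
           recurrent_walk M (rademacher_walk \<epsilon> (\<lambda>n. real (a n)))"
proof -
  interpret rademacher_sequence M \<epsilon>
    by fact
  obtain P :: "nat \<Rightarrow> nat list" where
    large: "\<And>k i. i < length (P k) \<Longrightarrow> f (Suc i) \<le> real (P k ! i)" and
    block: "\<And>k. \<exists>cs. cs \<noteq> [] \<and> P (Suc k) = P k @ cs \<and>
      (\<forall>x. \<bar>x\<bar> \<le> int (sum_list (P k)) \<longrightarrow> avoidance (map real cs) (of_int x) \<le> (1 / 2) ^ k)"
    using blocks_exist[OF assms(2)] by metis
  define t where "t k = length (P k)" for k
  have t_less: "t k < t (Suc k)" for k
    using block[of k] by (auto simp: t_def)
  then have "strict_mono t"
    by (rule strict_monoI_Suc)
  define a where "a n = P n ! (n - 1)" for n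
  have a_nth: "a (Suc i) = P k ! i" if "i < t k" for i k
  proof -
    have "\<exists>cs. cs \<noteq> [] \<and> P (Suc k) = P k @ cs" for k
      using block[of k] by blast
    then show ?thesis
      using that unfolding a_def diff_Suc_1 t_def by (rule nth_of_increasing_prefixes)
  qed
  have "f n \<le> real (a n)" if "1 \<le> n" for n
  proof -
    obtain i where n: "n = Suc i"
      using \<open>1 \<le> n\<close> by (cases n) auto
    have "i < t n"
      using strict_mono_imp_increasing[OF \<open>strict_mono t\<close>, of n] n by linarith
    then show ?thesis
      using large[of i n] a_nth[of i n] n by (simp add: t_def)
  qed
  moreover have "recurrent_walk M (rademacher_walk \<epsilon> (\<lambda>n. real (a n)))"
  proof (rule recurrent_if_summable_avoid[where t = t, OF t_less])
    have "prob (avoid (\<lambda>n. real (a n)) (t k) (t (Suc k))) \<le> (1 / 2) ^ k" for k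
    proof -
      obtain cs where cs: "P (Suc k) = P k @ cs" and
        hit: "\<And>x. \<bar>x\<bar> \<le> int (sum_list (P k)) \<Longrightarrow> avoidance (map real cs) (of_int x) \<le> (1 / 2) ^ k"
        using block[of k] by metis
      have t_Suc: "t (Suc k) = t k + length cs"
        by (simp add: t_def cs)
      have steps: "map (\<lambda>n. real (a n)) [Suc (t k)..<Suc (t k + length cs)] = map real cs"
      proof (rule nth_equalityI)
        fix i assume "i < length (map (\<lambda>n. real (a n)) [Suc (t k)..<Suc (t k + length cs)])"
        then have i: "i < length cs" by (simp del: upt_Suc)
        then have "a (Suc (t k + i)) = cs ! i"
          using a_nth[of "t k + i" "Suc k"] by (simp add: t_Suc cs t_def)
        then show "map (\<lambda>n. real (a n)) [Suc (t k)..<Suc (t k + length cs)] ! i = map real cs ! i"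
          using i by (simp del: upt_Suc)
      qed (simp del: upt_Suc)
      have "(\<Sum>n = 1..t k. a n) = (\<Sum>i<t k. a (Suc i))"
        by (simp add: sum.atLeast1_atMost_eq)
      also have "\<dots> = sum_list (P k)"
        using a_nth by (simp add: sum_list_sum_nth t_def atLeast0LessThan)
      finally have past: "(\<Sum>n = 1..t k. a n) = sum_list (P k)" .
      have "prob (avoid (\<lambda>n. real (a n)) (t k) (t k + length cs)) \<le> (1 / 2) ^ k"
      proof (rule prob_avoid_le)
        fix s assume s: "sign_sequence s"
        then obtain z :: "nat \<Rightarrow> int" where z: "\<And>n. s n = of_int (z n)" "\<And>n. \<bar>z n\<bar> = 1"
        proof (rule_tac that[of "\<lambda>n. if s n = 1 then 1 else - 1"])
          show "s n = of_int (if s n = 1 then 1 else - 1)" for n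
            using s by (auto simp: sign_sequence_def)
        qed auto
        let ?x = "\<Sum>n = 1..t k. z n * int (a n)"
        have "\<bar>?x\<bar> \<le> (\<Sum>n = 1..t k. \<bar>z n * int (a n)\<bar>)"
          by (rule sum_abs)
        also have "\<dots> = int (sum_list (P k))"
          by (simp add: abs_mult z(2) flip: past)
        finally have "avoidance (map real cs) (of_int ?x) \<le> (1 / 2) ^ k"
          by (rule hit)
        then show "avoidance (map (\<lambda>n. real (a n)) [Suc (t k)..<Suc (t k + length cs)])
            (\<Sum>n = 1..t k. s n * real (a n)) \<le> (1 / 2) ^ k"
          unfolding steps by (simp add: z(1))
      qed
      then show ?thesis
        by (simp add: t_Suc)
    qed
    then show "summable (\<lambda>k. prob (avoid (\<lambda>n. real (a n)) (t k) (t (Suc k))))"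
      by (intro summable_comparison_test'[OF summable_geometric[of "1 / 2 :: real"], of 0]) auto
  qed
  ultimately show ?thesis
    by blast
qed

end
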